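(* Let $d\geq 4$ and $k\geq 1$. Let $P_{d,k}(x_1,\dots,x_k)$ be the Dirichlet generating function of parallelogram polyhypercubes of dimension $d$ and width $k$, where $x_i$ marks the volume of the $i$-th plateau, i.e. $P_{d,k}(x_1,\dots,x_k)=\sum_{n_1,\dots,n_k\ge1} \frac{q_{n_1,\dots,n_k}}{n_1^{x_1}\cdots n_k^{x_k}}$ with $q_{n_1,\dots,n_k}$ the number of such polyhypercubes whose $i$-th plateau has volume $n_i$. Let $$V_k(x_1,\dots,x_k)=\sum_{n_1,\dots,n_k\geq 1}\frac{\prod_{j=1}^{k-1}\min(n_j,n_{j+1})}{n_1^{x_1}\cdots n_k^{x_k}}.$$ Then $P_{d,k}(x_1,\dots,x_k)=\big(V_k(x_1,\dots,x_k)\big)^{d-1}$.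
   Context: A $d$-dimensional polyhypercube is a finite set of unit hypercubes of $\mathbb{Z}^d$ (coordinates $(c_1,\dots,c_d)$), considered up to translation; its volume is its number of cells. A plateau is a set of cells with a single common first coordinate forming a full box $\{c: \beta_r\le c_r\le \tau_r \text{ for } 2\le r\le d\}$ without holes; for each direction $r\in\{2,\dots,d\}$ its bottom is $\beta_r$ and its top is $\tau_r$, and its volume is $\prod_{r=2}^d(\tau_r-\beta_r+1)$. A parallelogram polyhypercube of width $k$ is a union of $k$ plateaus $P_1,\dots,P_k$ at consecutive first coordinates $1,\dots,k$ such that, for every direction $r\in\{2,\dots,d\}$, the bottoms $\beta_r(P_\ell)$ and the tops $\tau_r(P_\ell)$ form weakly increasing sequences in $\ell$, and consecutive plateaus are connected through a $(d-1)$-dimensional face, i.e. $\beta_r(P_{\ell+1})\le\tau_r(P_\ell)$ for all $r$ and $1\le\ell\le k-1$. $V_k$ is the Dirichlet generating function of parallelogram polyominoes of width $k$ (the case $d=2$). Identities are of formal multiple Dirichlet series. *)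

theory Defs
  imports "HOL-Library.FuncSet" "HOL-Algebra.Group"
begin

type_synonym cell = "nat \<Rightarrow> int"

definition cells :: "nat \<Rightarrow> cell set" where
  "cells d = {1..d} \<rightarrow>\<^sub>E UNIV"

definition translate :: "nat \<Rightarrow> cell \<Rightarrow> cell set \<Rightarrow> cell set" where
  "translate d t S = (\<lambda>c. \<lambda>i\<in>{1..d}. c i + t i) ` S"

definition translation_rel :: "nat \<Rightarrow> (cell set \<times> cell set) set" where
  "translation_rel d = {(S, T). finite S \<and> S \<subseteq> cells d \<and> (\<exists>t. T = translate d t S)}"

definition polyhypercubes :: "nat \<Rightarrow> cell set set set" where
  "polyhypercubes d = {S. finite S \<and> S \<subseteq> cells d} // translation_rel d"

definition plateau :: "nat \<Rightarrow> int \<Rightarrow> (nat \<Rightarrow> int) \<Rightarrow> (nat \<Rightarrow> int) \<Rightarrow> cell set" where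
  "plateau d h \<beta> \<tau> = {c \<in> cells d. c 1 = h \<and> (\<forall>r\<in>{2..d}. \<beta> r \<le> c r \<and> c r \<le> \<tau> r)}"

text \<open>The bottom and top of the \<open>l\<close>-th plateau in direction \<open>r\<close> are \<open>\<beta> l r\<close> and \<open>\<tau> l r\<close>.\<close>

definition parallelogram_bounds ::
  "nat \<Rightarrow> nat \<Rightarrow> (nat \<Rightarrow> nat \<Rightarrow> int) \<Rightarrow> (nat \<Rightarrow> nat \<Rightarrow> int) \<Rightarrow> bool" where
  "parallelogram_bounds d k \<beta> \<tau> \<longleftrightarrow>
     (\<forall>l\<in>{1..k}. \<forall>r\<in>{2..d}. \<beta> l r \<le> \<tau> l r) \<and>
     (\<forall>r\<in>{2..d}. mono_on {1..k} (\<lambda>l. \<beta> l r) \<and> mono_on {1..k} (\<lambda>l. \<tau> l r)) \<and>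
     (\<forall>l\<in>{1..<k}. \<forall>r\<in>{2..d}. \<beta> (Suc l) r \<le> \<tau> l r)"

text \<open>A translation class is counted through its representative whose plateaus lie at first
  coordinates \<open>1, \<dots>, k\<close>; \<open>n i\<close> is the volume of the \<open>i\<close>-th plateau.\<close>

definition parallelogram_polyhypercubes :: "nat \<Rightarrow> nat \<Rightarrow> (nat \<Rightarrow> nat) \<Rightarrow> cell set set set" where
  "parallelogram_polyhypercubes d k n =
     {C \<in> polyhypercubes d. \<exists>\<beta> \<tau>. parallelogram_bounds d k \<beta> \<tau> \<and>
        (\<Union>l\<in>{1..k}. plateau d (int l) (\<beta> l) (\<tau> l)) \<in> C \<and>
        (\<forall>i\<in>{1..k}. card (plateau d (int i) (\<beta> i) (\<tau> i)) = n i)}"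

text \<open>A formal multiple Dirichlet series in \<open>k\<close> variables is its family of coefficients,
  indexed by the \<open>k\<close>-tuples of positive integers; the coefficient at \<open>n\<close> belongs to
  \<open>1 / (n 1 powr x 1 * \<dots> * n k powr x k)\<close>.  Multiplication is Dirichlet convolution.\<close>

definition dindex :: "nat \<Rightarrow> (nat \<Rightarrow> nat) set" where
  "dindex k = {1..k} \<rightarrow>\<^sub>E {1..}"

definition dirichlet_series :: "nat \<Rightarrow> ((nat \<Rightarrow> nat) \<Rightarrow> int) monoid" where
  "dirichlet_series k =
     \<lparr>carrier = dindex k \<rightarrow>\<^sub>E UNIV,
      mult = (\<lambda>f g. \<lambda>n\<in>dindex k.
        \<Sum>(a, b) | a \<in> dindex k \<and> b \<in> dindex k \<and> (\<forall>i\<in>{1..k}. a i * b i = n i). f a * g b),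
      one = (\<lambda>n\<in>dindex k. if \<forall>i\<in>{1..k}. n i = 1 then 1 else 0)\<rparr>"

definition P_series :: "nat \<Rightarrow> nat \<Rightarrow> (nat \<Rightarrow> nat) \<Rightarrow> int" where
  "P_series d k = (\<lambda>n\<in>dindex k. int (card (parallelogram_polyhypercubes d k n)))"

definition V_series :: "nat \<Rightarrow> (nat \<Rightarrow> nat) \<Rightarrow> int" where
  "V_series k = (\<lambda>n\<in>dindex k. \<Prod>j\<in>{1..<k}. int (min (n j) (n (Suc j))))"

lemma translate_cells: "translate d t S \<subseteq> cells d"
  by (auto simp: translate_def cells_def)

lemma translate_zero: "S \<subseteq> cells d \<Longrightarrow> translate d (\<lambda>_. 0) S = S"
proof -
  assume "S \<subseteq> cells d"
  then have "(\<lambda>i\<in>{1..d}. c i + 0) = c" if "c \<in> S" for c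
    using that unfolding cells_def by (auto simp: PiE_def extensional_restrict)
  then have "(\<lambda>c. \<lambda>i\<in>{1..d}. c i + 0) ` S = (\<lambda>c. c) ` S" by (intro image_cong refl) blast
  then show ?thesis unfolding translate_def by simp
qed

lemma translate_translate: "translate d u (translate d t S) = translate d (\<lambda>i. t i + u i) S"
  unfolding translate_def image_image by (intro image_cong refl) (auto simp: restrict_def)

lemma equiv_translation_rel: "equiv {S. finite S \<and> S \<subseteq> cells d} (translation_rel d)"
proof (rule equivI)
  show "translation_rel d \<subseteq> {S. finite S \<and> S \<subseteq> cells d} \<times> {S. finite S \<and> S \<subseteq> cells d}"
    using translate_cells by (auto simp: translation_rel_def) (simp add: translate_def)
  show "refl_on {S. finite S \<and> S \<subseteq> cells d} (translation_rel d)"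
    unfolding refl_on_def translation_rel_def using translate_zero[symmetric] by blast
  show "sym (translation_rel d)"
  proof (rule symI)
    fix S T assume "(S, T) \<in> translation_rel d"
    then obtain t where S: "finite S" "S \<subseteq> cells d" and T: "T = translate d t S"
      by (auto simp: translation_rel_def)
    have "S = translate d (\<lambda>i. - t i) T"
      using translate_zero[OF S(2)] by (simp add: T translate_translate)
    moreover have "finite T" using S by (simp add: T translate_def)
    ultimately show "(T, S) \<in> translation_rel d"
      using translate_cells T by (auto simp: translation_rel_def)
  qed
  show "trans (translation_rel d)"
    by (rule transI) (auto simp: translation_rel_def translate_translate)
qed

lemma card_plateau:
  assumes "d \<ge> 1" "\<And>r. r \<in> {2..d} \<Longrightarrow> \<beta> r \<le> \<tau> r"
  shows "int (card (plateau d h \<beta> \<tau>)) = (\<Prod>r\<in>{2..d}. \<tau> r - \<beta> r + 1)"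
proof -
  let ?B = "\<lambda>r. if r = 1 then {h} else {\<beta> r..\<tau> r}"
  have "plateau d h \<beta> \<tau> = PiE {1..d} ?B"
  proof (rule Set.set_eqI)
    fix c
    have "{1..d} = insert 1 {2..d}" using assms(1) by auto
    then show "c \<in> plateau d h \<beta> \<tau> \<longleftrightarrow> c \<in> PiE {1..d} ?B"
      by (simp add: plateau_def cells_def PiE_iff) blast
  qed
  then have "int (card (plateau d h \<beta> \<tau>)) = (\<Prod>r\<in>{1..d}. int (card (?B r)))"
    by (simp add: card_PiE)
  also have "{1..d} = insert 1 {2..d}" using assms(1) by auto
  also have "(\<Prod>r\<in>insert 1 {2..d}. int (card (?B r))) = (\<Prod>r\<in>{2..d}. int (card (?B r)))" by simp
  also have "\<dots> = (\<Prod>r\<in>{2..d}. \<tau> r - \<beta> r + 1)"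
    proof (intro prod.cong refl)
    fix r assume "r \<in> {2..d}"
    then show "int (card (?B r)) = \<tau> r - \<beta> r + 1" using assms(2)[of r] by simp
  qed
  finally show ?thesis .
qed

end

theory Submission
  imports Defs
begin

text \<open>Up to translation, a parallelogram polyhypercube is determined by the side lengths of its
  plateaus in each direction \<open>r \<in> {2..d}\<close> together with the offsets between the bottoms of
  consecutive plateaus. The directions are independent of each other, and between side lengths
  \<open>a\<close> and \<open>b\<close> there are \<open>min a b\<close> admissible offsets, so each direction contributes a
  coefficient of \<open>V_series k\<close>. Since volumes multiply over the \<open>d - 1\<close> directions, the number of
  polyhypercubes with given plateau volumes is a \<open>(d - 1)\<close>-fold Dirichlet convolution.\<close>

section \<open>Powers of formal multiple Dirichlet series\<close>

text \<open>The factors are labelled by an arbitrary set \<open>R\<close> instead of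
  \<open>1, ..., m\<close>, so that \<open>R\<close> can later be the set of directions
  \<open>{2..d}\<close> itself, or \<open>bool\<close> for a pair of factors.\<close>

definition factorizations :: "nat \<Rightarrow> 'r set \<Rightarrow> (nat \<Rightarrow> nat) \<Rightarrow> ('r \<Rightarrow> nat \<Rightarrow> nat) set" where
  "factorizations k R n = {W \<in> R \<rightarrow>\<^sub>E dindex k. \<forall>i\<in>{1..k}. (\<Prod>r\<in>R. W r i) = n i}"

text \<open>Every entry of a factor divides the corresponding entry of \<open>n\<close>. That entry
  is positive, so all factors are bounded by the largest entry of \<open>n\<close>.\<close>

lemma finite_factorizations:
  assumes "finite R" "n \<in> dindex k"
  shows "finite (factorizations k R n)"
proof (rule finite_subset)
  show "factorizations k R n \<subseteq> (R \<rightarrow>\<^sub>E ({1..k} \<rightarrow>\<^sub>E {..Max (n ` {1..k})}))"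
  proof
    fix W assume W: "W \<in> factorizations k R n"
    have "W r \<in> {1..k} \<rightarrow>\<^sub>E {..Max (n ` {1..k})}" if r: "r \<in> R" for r
    proof (rule PiE_I)
      fix i assume i: "i \<in> {1..k}"
      have "W r i dvd n i"
        using W r i assms(1) dvd_prodI[of R r "\<lambda>r. W r i"] by (auto simp: factorizations_def)
      moreover have "n i > 0" using i assms(2) by (auto simp: dindex_def PiE_iff Suc_le_eq)
      ultimately have "W r i \<le> n i" by (rule dvd_imp_le)
      also have "\<dots> \<le> Max (n ` {1..k})" using i by (intro Max_ge) auto
      finally show "W r i \<in> {..Max (n ` {1..k})}" by simp
    next
      fix i assume "i \<notin> {1..k}"
      then show "W r i = undefined"
        using W r by (force simp: factorizations_def dindex_def PiE_iff extensional_def)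
    qed
    then show "W \<in> R \<rightarrow>\<^sub>E ({1..k} \<rightarrow>\<^sub>E {..Max (n ` {1..k})})"
      using W by (auto simp: factorizations_def PiE_iff)
  qed
  show "finite (R \<rightarrow>\<^sub>E ({1..k} \<rightarrow>\<^sub>E {..Max (n ` {1..k})}))"
    using assms(1) by (intro finite_PiE) auto
qed

text \<open>A pair in a Dirichlet convolution is a factorization labelled by \<open>bool\<close>, so
  the previous bound applies.\<close>

lemma finite_dirichlet_pairs:
  assumes "n \<in> dindex k"
  shows "finite {(a, b). a \<in> dindex k \<and> b \<in> dindex k \<and> (\<forall>i\<in>{1..k}. a i * b i = n i)}"
    (is "finite ?S")
proof (rule finite_subset)
  show "?S \<subseteq> (\<lambda>W. (W False, W True)) ` factorizations k (UNIV :: bool set) n"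
  proof clarify
    fix a b assume "a \<in> dindex k" "b \<in> dindex k" "\<forall>i\<in>{1..k}. a i * b i = n i"
    then have "(\<lambda>c. if c then b else a) \<in> factorizations k UNIV n"
      by (auto simp: factorizations_def UNIV_bool)
    then show "(a, b) \<in> (\<lambda>W. (W False, W True)) ` factorizations k UNIV n"
      by (rule rev_image_eqI) simp
  qed
  show "finite ((\<lambda>W. (W False, W True)) ` factorizations k (UNIV :: bool set) n)"
    using assms by (simp add: finite_factorizations)
qed

text \<open>Expanding a power of a series leaves one choice of index tuple per factor. The induction
  removes one label at a time, following the recursion that multiplies the power by \<open>f\<close>
  on the right.\<close>

lemma dirichlet_pow_coeff:
  fixes R :: "'r set"
  assumes "finite R" "n \<in> dindex k"
  shows "(f [^]\<^bsub>dirichlet_series k\<^esub> card R) n = (\<Sum>W\<in>factorizations k R n. \<Prod>r\<in>R. f (W r))"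
  using assms
proof (induction R arbitrary: n rule: finite_induct)
  case empty
  \<comment> \<open>An empty product is 1 in every coordinate, so only the all-ones tuple has a
    factorization. This is the support of the unit series.\<close>
  have "factorizations k ({} :: 'r set) n = (if \<forall>i\<in>{1..k}. n i = 1 then {\<lambda>_. undefined} else {})"
    by (simp add: factorizations_def) (metis One_nat_def)
  with empty show ?case by (simp add: nat_pow_def dirichlet_series_def)
next
  case (insert x F)
  let ?pairs = "{(a, b). a \<in> dindex k \<and> b \<in> dindex k \<and> (\<forall>i\<in>{1..k}. a i * b i = n i)}"
  have "(f [^]\<^bsub>dirichlet_series k\<^esub> card (insert x F)) n
      = (\<Sum>(a, b)\<in>?pairs. (f [^]\<^bsub>dirichlet_series k\<^esub> card F) a * f b)"
    using insert.hyps insert.prems by (simp add: nat_pow_def dirichlet_series_def)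
  also have "\<dots> = (\<Sum>p\<in>?pairs. \<Sum>W\<in>factorizations k F (fst p). (\<Prod>r\<in>F. f (W r)) * f (snd p))"
    using insert.IH by (intro sum.cong) (auto simp: sum_distrib_right)
  also have "\<dots> = (\<Sum>(p, W)\<in>(SIGMA p:?pairs. factorizations k F (fst p)).
      (\<Prod>r\<in>F. f (W r)) * f (snd p))"
    using finite_dirichlet_pairs[OF insert.prems] insert.hyps
    by (intro sum.Sigma) (auto intro: finite_factorizations)
  also have "\<dots> = (\<Sum>W\<in>factorizations k (insert x F) n. \<Prod>r\<in>insert x F. f (W r))"
  \<comment> \<open>Forward, the right factor of the pair becomes the value at the new label
    \<open>x\<close>. Backward, the left factor is recovered as the coordinatewise product over
    \<open>F\<close>.\<close>
  proof (rule sum.reindex_bij_witness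
      [where j = "\<lambda>(p, W). W(x := snd p)"
         and i = "\<lambda>W. ((\<lambda>i\<in>{1..k}. \<Prod>r\<in>F. W r i, W x), restrict W F)"])
    fix q assume q: "q \<in> (SIGMA p:?pairs. factorizations k F (fst p))"
    obtain a b W where q_eq: "q = ((a, b), W)" by (metis surj_pair)
    from q have ab: "a \<in> dindex k" "b \<in> dindex k" "\<And>i. i \<in> {1..k} \<Longrightarrow> a i * b i = n i"
      and W: "W \<in> F \<rightarrow>\<^sub>E dindex k" "\<And>i. i \<in> {1..k} \<Longrightarrow> (\<Prod>r\<in>F. W r i) = a i"
      by (auto simp: q_eq factorizations_def)
    have upd: "(\<Prod>r\<in>F. (W(x := b)) r i) = (\<Prod>r\<in>F. W r i)" for i
      using insert.hyps by (intro prod.cong) auto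
    have updf: "(\<Prod>r\<in>F. f ((W(x := b)) r)) = (\<Prod>r\<in>F. f (W r))"
      using insert.hyps by (intro prod.cong) auto
    have "(\<lambda>i\<in>{1..k}. \<Prod>r\<in>F. (W(x := b)) r i) = a"
      unfolding upd using ab(1) W(2) by (auto simp: dindex_def PiE_iff extensional_def fun_eq_iff)
    moreover have "restrict (W(x := b)) F = W"
      using W(1) insert.hyps by (auto simp: PiE_iff extensional_def fun_eq_iff)
    ultimately show "(\<lambda>W. ((\<lambda>i\<in>{1..k}. \<Prod>r\<in>F. W r i, W x), restrict W F))
        ((\<lambda>(p, W). W(x := snd p)) q) = q"
      by (simp add: q_eq)
    have "W(x := b) \<in> insert x F \<rightarrow>\<^sub>E dindex k"
      using W(1) ab(2) by (intro PiE_fun_upd)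
    then show "(\<lambda>(p, W). W(x := snd p)) q \<in> factorizations k (insert x F) n"
      using insert.hyps ab(3) W(2) upd by (simp add: q_eq factorizations_def mult.commute)
    show "(\<Prod>r\<in>insert x F. f (((\<lambda>(p, W). W(x := snd p)) q) r)) =
        (case q of (p, W) \<Rightarrow> (\<Prod>r\<in>F. f (W r)) * f (snd p))"
      using insert.hyps updf by (simp add: q_eq mult.commute)
  next
    fix W assume W: "W \<in> factorizations k (insert x F) n"
    let ?a = "\<lambda>i\<in>{1..k}. \<Prod>r\<in>F. W r i"
    have WPi: "W \<in> insert x F \<rightarrow>\<^sub>E dindex k"
      and Wn: "\<And>i. i \<in> {1..k} \<Longrightarrow> W x i * (\<Prod>r\<in>F. W r i) = n i"
      using W insert.hyps by (auto simp: factorizations_def)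
    have pos: "W r i \<ge> 1" if "r \<in> F" "i \<in> {1..k}" for r i
      using WPi that by (auto simp: dindex_def PiE_iff)
    have "?a \<in> dindex k"
      using pos by (auto simp: dindex_def Suc_le_eq intro!: prod_pos)
    moreover have "W x \<in> dindex k" using WPi by auto
    moreover have "restrict W F \<in> factorizations k F ?a"
      using WPi by (auto simp: factorizations_def)
    ultimately show "((?a, W x), restrict W F) \<in> (SIGMA p:?pairs. factorizations k F (fst p))"
      using Wn by (auto simp: mult.commute)
    show "(\<lambda>(p, W). W(x := snd p)) ((?a, W x), restrict W F) = W"
      using WPi by (auto simp: PiE_iff extensional_def fun_eq_iff)
  qed
  finally show ?case .
qed

section \<open>Stacks of plateaus and their translates\<close>

definition stack :: "nat \<Rightarrow> nat \<Rightarrow> (nat \<Rightarrow> nat \<Rightarrow> int) \<Rightarrow> (nat \<Rightarrow> nat \<Rightarrow> int) \<Rightarrow> cell set" where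
  "stack d k \<beta> \<tau> = (\<Union>l\<in>{1..k}. plateau d (int l) (\<beta> l) (\<tau> l))"

text \<open>Writing the fixed first coordinate as a singleton side makes the plateau a full product,
  so general facts about \<open>PiE\<close> give finiteness, nonemptiness and uniqueness of the
  sides.\<close>

lemma plateau_eq_PiE:
  assumes "d \<ge> 1"
  shows "plateau d h \<beta> \<tau> = (\<Pi>\<^sub>E r\<in>{1..d}. if r = 1 then {h} else {\<beta> r..\<tau> r})"
proof -
  have "{1..d} = insert 1 {2..d}" using assms by auto
  then show ?thesis
    by (intro Set.set_eqI) (simp add: plateau_def cells_def PiE_iff, blast)
qed

lemma finite_plateau: "d \<ge> 1 \<Longrightarrow> finite (plateau d h \<beta> \<tau>)"
  by (simp add: plateau_eq_PiE finite_PiE)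

lemma plateau_nonempty:
  assumes "d \<ge> 1" "\<And>r. r \<in> {2..d} \<Longrightarrow> \<beta> r \<le> \<tau> r"
  shows "plateau d h \<beta> \<tau> \<noteq> {}"
  using assms by (auto simp: plateau_eq_PiE PiE_eq_empty_iff)

lemma plateau_cong:
  assumes "\<And>r. r \<in> {2..d} \<Longrightarrow> \<beta> r = \<beta>' r" "\<And>r. r \<in> {2..d} \<Longrightarrow> \<tau> r = \<tau>' r"
  shows "plateau d h \<beta> \<tau> = plateau d h \<beta>' \<tau>'"
  using assms by (auto simp: plateau_def)

lemma plateau_eqD:
  assumes "d \<ge> 1" "plateau d h \<beta> \<tau> = plateau d h \<beta>' \<tau>'"
    and "\<And>r. r \<in> {2..d} \<Longrightarrow> \<beta> r \<le> \<tau> r" "\<And>r. r \<in> {2..d} \<Longrightarrow> \<beta>' r \<le> \<tau>' r"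
    and r: "r \<in> {2..d}"
  shows "\<beta> r = \<beta>' r \<and> \<tau> r = \<tau>' r"
proof -
  let ?B = "\<lambda>\<beta> \<tau> r. if r = (1::nat) then {h} else {\<beta> r..\<tau> r :: int}"
  have "PiE {1..d} (?B \<beta> \<tau>) = PiE {1..d} (?B \<beta>' \<tau>')"
    using assms(1,2) by (simp add: plateau_eq_PiE)
  moreover have "\<forall>i\<in>{1..d}. ?B \<beta> \<tau> i \<noteq> {}" "\<forall>i\<in>{1..d}. ?B \<beta>' \<tau>' i \<noteq> {}"
    using assms(3,4) by auto
  ultimately have "\<forall>i\<in>{1..d}. ?B \<beta> \<tau> i = ?B \<beta>' \<tau>' i" by (subst (asm) PiE_eq_iff) blast
  moreover have "r \<in> {1..d}" "r \<noteq> 1" using r by auto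
  ultimately have "{\<beta> r..\<tau> r} = {\<beta>' r..\<tau>' r}" by (auto dest!: bspec[of _ _ r])
  then show ?thesis using assms(3)[OF r] by (simp add: Icc_eq_Icc)
qed

lemma translate_plateau:
  assumes "d \<ge> 1"
  shows "translate d t (plateau d h \<beta> \<tau>) =
    plateau d (h + t 1) (\<lambda>r. \<beta> r + t r) (\<lambda>r. \<tau> r + t r)"
proof
  show "translate d t (plateau d h \<beta> \<tau>) \<subseteq>
      plateau d (h + t 1) (\<lambda>r. \<beta> r + t r) (\<lambda>r. \<tau> r + t r)"
    using assms by (auto simp: translate_def plateau_def cells_def)
  show "plateau d (h + t 1) (\<lambda>r. \<beta> r + t r) (\<lambda>r. \<tau> r + t r) \<subseteq>
      translate d t (plateau d h \<beta> \<tau>)"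
  proof
    fix c assume c: "c \<in> plateau d (h + t 1) (\<lambda>r. \<beta> r + t r) (\<lambda>r. \<tau> r + t r)"
    have "(\<lambda>i\<in>{1..d}. c i - t i) \<in> plateau d h \<beta> \<tau>"
      using c assms by (force simp: plateau_def cells_def)
    moreover have "c = (\<lambda>i\<in>{1..d}. (\<lambda>i\<in>{1..d}. c i - t i) i + t i)"
      using c by (auto simp: plateau_def cells_def PiE_iff extensional_def fun_eq_iff)
    ultimately show "c \<in> translate d t (plateau d h \<beta> \<tau>)"
      unfolding translate_def by blast
  qed
qed

lemma translate_stack:
  assumes "d \<ge> 1"
  shows "translate d t (stack d k \<beta> \<tau>) =
    (\<Union>l\<in>{1..k}. plateau d (int l + t 1) (\<lambda>r. \<beta> l r + t r) (\<lambda>r. \<tau> l r + t r))"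
proof -
  have "translate d t (stack d k \<beta> \<tau>) =
      (\<Union>l\<in>{1..k}. translate d t (plateau d (int l) (\<beta> l) (\<tau> l)))"
    by (simp add: stack_def translate_def image_UN)
  then show ?thesis unfolding translate_plateau[OF assms] .
qed

lemma stack_polyhypercube: "d \<ge> 1 \<Longrightarrow> finite (stack d k \<beta> \<tau>) \<and> stack d k \<beta> \<tau> \<subseteq> cells d"
  by (auto simp: stack_def finite_plateau) (simp add: plateau_def)

text \<open>Distinct plateaus have distinct first coordinates, so the union of the plateaus still
  determines each of them.\<close>

lemma stack_slice:
  "l \<in> {1..k} \<Longrightarrow> {c \<in> stack d k \<beta> \<tau>. c 1 = int l} = plateau d (int l) (\<beta> l) (\<tau> l)"
  by (auto simp: stack_def plateau_def)

lemma stack_heights: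
  assumes "d \<ge> 1" "parallelogram_bounds d k \<beta> \<tau>"
  shows "(\<lambda>c. c 1) ` stack d k \<beta> \<tau> = int ` {1..k}"
proof -
  have "(\<lambda>c. c 1) ` plateau d (int l) (\<beta> l) (\<tau> l) = {int l}" if "l \<in> {1..k}" for l
  proof -
    have "plateau d (int l) (\<beta> l) (\<tau> l) \<noteq> {}"
      using assms that by (intro plateau_nonempty) (auto simp: parallelogram_bounds_def)
    then show ?thesis by (auto simp: plateau_def)
  qed
  then have "(\<lambda>c. c 1) ` stack d k \<beta> \<tau> = (\<Union>l\<in>{1..k}. {int l})"
    unfolding stack_def image_UN by (intro SUP_cong) auto
  then show ?thesis by auto
qed

text \<open>Both stacks occupy the same first coordinates, which rules out a shift in direction 1.
  Slices at equal height are then equal boxes, and their bounds can be compared.\<close>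

lemma stack_translate_eqD:
  assumes d: "d \<ge> 1" and k: "k \<ge> 1"
    and b: "parallelogram_bounds d k \<beta> \<tau>" and b': "parallelogram_bounds d k \<beta>' \<tau>'"
    and eq: "stack d k \<beta>' \<tau>' = translate d t (stack d k \<beta> \<tau>)"
    and l: "l \<in> {1..k}" and r: "r \<in> {2..d}"
  shows "\<beta>' l r = \<beta> l r + t r \<and> \<tau>' l r = \<tau> l r + t r"
proof -
  let ?\<beta> = "\<lambda>l r. \<beta> l r + t r" and ?\<tau> = "\<lambda>l r. \<tau> l r + t r"
  have "(\<lambda>c. c 1) ` translate d t (stack d k \<beta> \<tau>) =
      (\<lambda>h. h + t 1) ` (\<lambda>c. c 1) ` stack d k \<beta> \<tau>"
    using d by (simp add: translate_def image_image)
  then have "int ` {1..k} = (\<lambda>h. h + t 1) ` int ` {1..k}"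
    using stack_heights[OF d b] stack_heights[OF d b'] eq by simp
  then have "{1..int k} = {1 + t 1..int k + t 1}"
    by (simp add: image_int_atLeastAtMost add.commute)
  \<comment> \<open>Since \<open>k \<ge> 1\<close>, the interval of heights is nonempty, and a
    nonempty finite interval equals its translate only for shift 0.\<close>
  then have t1: "t 1 = 0" using k by (simp add: Icc_eq_Icc)
  have "stack d k \<beta>' \<tau>' = stack d k ?\<beta> ?\<tau>"
    unfolding eq translate_stack[OF d] t1 by (simp add: stack_def)
  then have "plateau d (int l) (\<beta>' l) (\<tau>' l) = plateau d (int l) (?\<beta> l) (?\<tau> l)"
    using stack_slice[OF l, of d \<beta>' \<tau>'] stack_slice[OF l, of d ?\<beta> ?\<tau>] by simp
  then show ?thesis
    using plateau_eqD[OF d _ _ _ r, of "int l" "\<beta>' l" "\<tau>' l" "?\<beta> l" "?\<tau> l"] b b' l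
    by (auto simp: parallelogram_bounds_def)
qed

section \<open>Encoding by side lengths and shifts\<close>

text \<open>The possible offsets of the bottom of an interval of length \<open>b\<close> placed after one of
  length \<open>a\<close>: weakly increasing tops force the offset to be at least \<open>a - b\<close> (truncated),
  and contact forces it to be less than \<open>a\<close>.\<close>

definition shifts :: "nat \<Rightarrow> nat \<Rightarrow> nat set" where
  "shifts a b = {a - b..<a}"

text \<open>With truncated subtraction, \<open>a - (a - b)\<close> is \<open>min a b\<close>; this
  is the source of the minima in \<open>V_series\<close>.\<close>

lemma card_shifts: "card (shifts a b) = min a b"
  by (auto simp: shifts_def)

text \<open>The direction comes before the plateau index, opposite to \<beta> and \<tau>, so that
  \<open>W r\<close> is itself an index tuple of a series. The sum is dependent because the
  admissible offsets vary with the side lengths.\<close>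

definition encodings ::
  "nat \<Rightarrow> nat \<Rightarrow> (nat \<Rightarrow> nat) \<Rightarrow> ((nat \<Rightarrow> nat \<Rightarrow> nat) \<times> (nat \<Rightarrow> nat \<Rightarrow> nat)) set" where
  "encodings d k n = (SIGMA W:factorizations k {2..d} n.
     \<Pi>\<^sub>E r\<in>{2..d}. \<Pi>\<^sub>E j\<in>{1..<k}. shifts (W r j) (W r (Suc j)))"

lemma card_encodings:
  assumes "n \<in> dindex k"
  shows "card (encodings d k n) =
    (\<Sum>W\<in>factorizations k {2..d} n. \<Prod>r\<in>{2..d}. \<Prod>j\<in>{1..<k}. min (W r j) (W r (Suc j)))"
proof -
  have "card (encodings d k n) = (\<Sum>W\<in>factorizations k {2..d} n.
      card (\<Pi>\<^sub>E r\<in>{2..d}. \<Pi>\<^sub>E j\<in>{1..<k}. shifts (W r j) (W r (Suc j))))"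
    unfolding encodings_def using assms
    by (intro card_SigmaI) (auto intro!: finite_factorizations finite_PiE simp: shifts_def)
  then show ?thesis by (simp add: card_PiE card_shifts)
qed

text \<open>This fixes a representative of the translation class: the first plateau has bottom 0 in
  every direction, as the sum is empty for \<open>l = 1\<close>.\<close>

definition bottoms :: "(nat \<Rightarrow> nat \<Rightarrow> nat) \<Rightarrow> nat \<Rightarrow> nat \<Rightarrow> int" where
  "bottoms S l r = (\<Sum>j\<in>{1..<l}. int (S r j))"

definition tops :: "(nat \<Rightarrow> nat \<Rightarrow> nat) \<Rightarrow> (nat \<Rightarrow> nat \<Rightarrow> nat) \<Rightarrow> nat \<Rightarrow> nat \<Rightarrow> int" where
  "tops W S l r = bottoms S l r + int (W r l) - 1"

lemma bottoms_Suc: "l \<ge> 1 \<Longrightarrow> bottoms S (Suc l) r = bottoms S l r + int (S r l)"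
  by (simp add: bottoms_def)

lemma mono_on_atLeastAtMostI:
  fixes f :: "nat \<Rightarrow> int"
  assumes "\<And>l. l \<in> {m..<k} \<Longrightarrow> f l \<le> f (Suc l)"
  shows "mono_on {m..k} f"
proof (rule mono_onI)
  fix x y assume "x \<in> {m..k}" "y \<in> {m..k}" "x \<le> y"
  from \<open>x \<le> y\<close> have "y \<le> k \<longrightarrow> f x \<le> f y"
  proof (induction y rule: dec_induct)
    case (step y)
    then show ?case using assms[of y] \<open>x \<in> {m..k}\<close> by fastforce
  qed simp
  then show "f x \<le> f y" using \<open>y \<in> {m..k}\<close> by simp
qed

text \<open>The upper bound in \<open>shifts\<close> is contact and the lower bound is monotonicity
  of the tops. The bottoms increase because offsets are natural numbers.\<close>

lemma encodings_bounds:
  assumes "(W, S) \<in> encodings d k n"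
  shows "parallelogram_bounds d k (bottoms S) (tops W S)"
proof -
  have W: "W r l \<ge> 1" if "r \<in> {2..d}" "l \<in> {1..k}" for r l
    using assms that by (auto simp: encodings_def factorizations_def dindex_def PiE_iff)
  have S: "S r l < W r l \<and> W r l \<le> W r (Suc l) + S r l"
    if "r \<in> {2..d}" "l \<in> {1..<k}" for r l
  proof -
    have "S r l \<in> shifts (W r l) (W r (Suc l))"
      using assms that by (auto simp: encodings_def PiE_iff)
    then show ?thesis by (auto simp: shifts_def)
  qed
  show ?thesis
    unfolding parallelogram_bounds_def
  proof (intro conjI ballI mono_on_atLeastAtMostI)
    fix l r assume "l \<in> {1..k}" "r \<in> {2..d}"
    then show "bottoms S l r \<le> tops W S l r" using W[of r l] by (simp add: tops_def)
  next
    fix r l assume "r \<in> {2..d}" "l \<in> {1..<k}"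
    then show "bottoms S l r \<le> bottoms S (Suc l) r" by (simp add: bottoms_Suc)
  next
    fix r l assume "r \<in> {2..d}" "l \<in> {1..<k}"
    then show "tops W S l r \<le> tops W S (Suc l) r"
      using S[of r l] by (simp add: tops_def bottoms_Suc)
  next
    fix l r assume "l \<in> {1..<k}" "r \<in> {2..d}"
    then show "bottoms S (Suc l) r \<le> tops W S l r"
      using S[of r l] by (simp add: tops_def bottoms_Suc)
  qed
qed

lemma card_plateau_encoding:
  assumes "d \<ge> 1" "(W, S) \<in> encodings d k n" "i \<in> {1..k}"
  shows "card (plateau d (int i) (bottoms S i) (tops W S i)) = n i"
proof -
  have "int (card (plateau d (int i) (bottoms S i) (tops W S i))) =
      (\<Prod>r\<in>{2..d}. tops W S i r - bottoms S i r + 1)"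
    using encodings_bounds[OF assms(2)] assms(1,3)
    by (intro card_plateau) (auto simp: parallelogram_bounds_def)
  also have "\<dots> = int (\<Prod>r\<in>{2..d}. W r i)" by (simp add: tops_def)
  also have "\<dots> = int (n i)"
    using assms(2,3) by (auto simp: encodings_def factorizations_def)
  finally show ?thesis by simp
qed

text \<open>Side lengths are differences of top and bottom, and offsets are differences of
  consecutive bottoms. The translation \<open>t\<close> cancels in both.\<close>

lemma encodings_inj:
  assumes d: "d \<ge> 1" and k: "k \<ge> 1"
    and e: "(W, S) \<in> encodings d k n" and e': "(W', S') \<in> encodings d k n"
    and eq: "stack d k (bottoms S') (tops W' S') = translate d t (stack d k (bottoms S) (tops W S))"
  shows "W = W' \<and> S = S'"
proof -
  have bt: "bottoms S' l r = bottoms S l r + t r \<and> tops W' S' l r = tops W S l r + t r"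
    if "l \<in> {1..k}" "r \<in> {2..d}" for l r
    using stack_translate_eqD[OF d k encodings_bounds[OF e] encodings_bounds[OF e'] eq that] .
  have "W = W'"
  proof (rule extensionalityI)
    show "W \<in> extensional {2..d}" "W' \<in> extensional {2..d}"
      using e e' by (simp_all add: encodings_def factorizations_def PiE_iff)
    fix r assume r: "r \<in> {2..d}"
    show "W r = W' r"
    proof (rule extensionalityI)
      show "W r \<in> extensional {1..k}" "W' r \<in> extensional {1..k}"
        using e e' r by (simp_all add: encodings_def factorizations_def dindex_def PiE_iff)
      show "W r l = W' r l" if "l \<in> {1..k}" for l
        using bt[OF that r] by (simp add: tops_def)
    qed
  qed
  moreover have "S = S'"
  proof (rule extensionalityI)
    show "S \<in> extensional {2..d}" "S' \<in> extensional {2..d}"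
      using e e' by (simp_all add: encodings_def PiE_iff)
    fix r assume r: "r \<in> {2..d}"
    show "S r = S' r"
    proof (rule extensionalityI)
      show "S r \<in> extensional {1..<k}" "S' r \<in> extensional {1..<k}"
        using e e' r by (simp_all add: encodings_def PiE_iff)
      show "S r l = S' r l" if "l \<in> {1..<k}" for l
        using bt[of l r] bt[of "Suc l" r] that r by (simp add: bottoms_Suc)
    qed
  qed
  ultimately show ?thesis ..
qed

lemma encodings_surj:
  assumes d: "d \<ge> 1" and b: "parallelogram_bounds d k \<beta> \<tau>"
    and n: "\<And>i. i \<in> {1..k} \<Longrightarrow> card (plateau d (int i) (\<beta> i) (\<tau> i)) = n i"
  obtains W S t where "(W, S) \<in> encodings d k n"
    and "stack d k \<beta> \<tau> = translate d t (stack d k (bottoms S) (tops W S))"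
proof -
  \<comment> \<open>Truncation by \<open>nat\<close> loses nothing on the index ranges:
    \<open>le\<close> and \<open>step\<close> below show that the converted differences are
    nonnegative.\<close>
  define W where "W = (\<lambda>r\<in>{2..d}. \<lambda>l\<in>{1..k}. nat (\<tau> l r - \<beta> l r + 1))"
  define S where "S = (\<lambda>r\<in>{2..d}. \<lambda>l\<in>{1..<k}. nat (\<beta> (Suc l) r - \<beta> l r))"
  \<comment> \<open>Both stacks start at height 1, hence no shift in direction 1. In the other
    directions the shift moves the first bottom from 0 to \<open>\<beta> 1 r\<close>.\<close>
  define t where "t = (\<lambda>r. if r = 1 then 0 else \<beta> 1 r)"
  have le: "\<beta> l r \<le> \<tau> l r" if "l \<in> {1..k}" "r \<in> {2..d}" for l r
    using b that by (auto simp: parallelogram_bounds_def)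
  have step: "\<beta> l r \<le> \<beta> (Suc l) r" "\<tau> l r \<le> \<tau> (Suc l) r" "\<beta> (Suc l) r \<le> \<tau> l r"
    if "l \<in> {1..<k}" "r \<in> {2..d}" for l r
  proof -
    have "mono_on {1..k} (\<lambda>l. \<beta> l r)" "mono_on {1..k} (\<lambda>l. \<tau> l r)"
      using b that by (auto simp: parallelogram_bounds_def)
    then show "\<beta> l r \<le> \<beta> (Suc l) r" "\<tau> l r \<le> \<tau> (Suc l) r"
      using that by (auto elim!: mono_onD)
    show "\<beta> (Suc l) r \<le> \<tau> l r" using b that by (auto simp: parallelogram_bounds_def)
  qed
  have W: "int (W r l) = \<tau> l r - \<beta> l r + 1" if "l \<in> {1..k}" "r \<in> {2..d}" for l r
    using le[OF that] that by (simp add: W_def)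
  have S: "int (S r l) = \<beta> (Suc l) r - \<beta> l r" if "l \<in> {1..<k}" "r \<in> {2..d}" for l r
    using step[OF that] that by (simp add: S_def)
  have "(\<Prod>r\<in>{2..d}. W r i) = n i" if i: "i \<in> {1..k}" for i
  proof -
    have "int (\<Prod>r\<in>{2..d}. W r i) = (\<Prod>r\<in>{2..d}. \<tau> i r - \<beta> i r + 1)"
      unfolding of_nat_prod using W[OF i] by (intro prod.cong) auto
    also have "\<dots> = int (card (plateau d (int i) (\<beta> i) (\<tau> i)))"
      using d le[OF i] by (intro card_plateau[symmetric]) auto
    finally show ?thesis unfolding n[OF i] of_nat_eq_iff .
  qed
  moreover have "W \<in> {2..d} \<rightarrow>\<^sub>E dindex k"
    using le by (fastforce simp: W_def dindex_def)
  ultimately have "W \<in> factorizations k {2..d} n" by (simp add: factorizations_def)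
  moreover have "S r j \<in> shifts (W r j) (W r (Suc j))" if "r \<in> {2..d}" "j \<in> {1..<k}" for r j
    using S[of j r] W[of j r] W[of "Suc j" r] step[of j r] that by (auto simp: shifts_def)
  then have "S \<in> (\<Pi>\<^sub>E r\<in>{2..d}. \<Pi>\<^sub>E j\<in>{1..<k}. shifts (W r j) (W r (Suc j)))"
    by (auto simp: PiE_iff) (auto simp: S_def)
  ultimately have e: "(W, S) \<in> encodings d k n" by (simp add: encodings_def)
  \<comment> \<open>The offsets telescope to the difference between the current bottom and the first
    one.\<close>
  have bot: "bottoms S l r + \<beta> 1 r = \<beta> l r" if "l \<in> {1..k}" "r \<in> {2..d}" for l r
  proof -
    have "bottoms S l r = (\<Sum>j\<in>{1..<l}. \<beta> (Suc j) r - \<beta> j r)"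
      unfolding bottoms_def using that S by (intro sum.cong) auto
    also have "\<dots> = \<beta> l r - \<beta> 1 r"
      using that by (intro sum_Suc_diff') auto
    finally show ?thesis by simp
  qed
  have "plateau d (int l + t 1) (\<lambda>r. bottoms S l r + t r) (\<lambda>r. tops W S l r + t r) =
      plateau d (int l) (\<beta> l) (\<tau> l)" if "l \<in> {1..k}" for l
  proof -
    have "bottoms S l r + t r = \<beta> l r \<and> tops W S l r + t r = \<tau> l r" if "r \<in> {2..d}" for r
      using bot[OF \<open>l \<in> {1..k}\<close> that] W[OF \<open>l \<in> {1..k}\<close> that] that by (simp add: t_def tops_def)
    then have "plateau d (int l) (\<lambda>r. bottoms S l r + t r) (\<lambda>r. tops W S l r + t r) =
        plateau d (int l) (\<beta> l) (\<tau> l)"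
      by (intro plateau_cong) blast+
    moreover have "t 1 = 0" by (simp add: t_def)
    ultimately show ?thesis by simp
  qed
  then have "stack d k \<beta> \<tau> = translate d t (stack d k (bottoms S) (tops W S))"
    unfolding translate_stack[OF d] by (simp add: stack_def)
  with e show ?thesis by (rule that)
qed

section \<open>Counting translation classes by encodings\<close>

lemma card_parallelogram_polyhypercubes:
  assumes d: "d \<ge> 1" and k: "k \<ge> 1"
  shows "card (parallelogram_polyhypercubes d k n) = card (encodings d k n)"
proof -
  let ?A = "{S. finite S \<and> S \<subseteq> cells d}"
  \<comment> \<open>An encoding is sent to the class of its normalized stack. Injectivity is
    \<open>encodings_inj\<close>, and surjectivity comes from \<open>encodings_surj\<close>.\<close>
  let ?\<Phi> = "\<lambda>(W, S). translation_rel d `` {stack d k (bottoms S) (tops W S)}"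
  note equiv = equiv_translation_rel[of d]
  have "bij_betw ?\<Phi> (encodings d k n) (parallelogram_polyhypercubes d k n)"
    unfolding bij_betw_def
  proof (intro conjI equalityI)
    show "inj_on ?\<Phi> (encodings d k n)"
    proof (rule inj_onI, clarify)
      fix W S W' S'
      assume e: "(W, S) \<in> encodings d k n" "(W', S') \<in> encodings d k n"
        and "translation_rel d `` {stack d k (bottoms S) (tops W S)} =
          translation_rel d `` {stack d k (bottoms S') (tops W' S')}"
      then have "(stack d k (bottoms S) (tops W S), stack d k (bottoms S') (tops W' S'))
          \<in> translation_rel d"
        using eq_equiv_class[OF _ equiv] stack_polyhypercube[OF d] by simp
      then obtain t where "stack d k (bottoms S') (tops W' S') =
          translate d t (stack d k (bottoms S) (tops W S))"
        by (auto simp: translation_rel_def)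
      then show "W = W' \<and> S = S'" using encodings_inj[OF d k e] by blast
    qed
    show "?\<Phi> ` encodings d k n \<subseteq> parallelogram_polyhypercubes d k n"
    proof clarify
      fix W S assume e: "(W, S) \<in> encodings d k n"
      let ?X = "stack d k (bottoms S) (tops W S)"
      have X: "?X \<in> ?A" using stack_polyhypercube[OF d] by simp
      have "translation_rel d `` {?X} \<in> polyhypercubes d"
        unfolding polyhypercubes_def using X by (rule quotientI)
      moreover have "?X \<in> translation_rel d `` {?X}"
        using X by (rule equiv_class_self[OF equiv])
      ultimately show "translation_rel d `` {?X} \<in> parallelogram_polyhypercubes d k n"
        using encodings_bounds[OF e] card_plateau_encoding[OF d e]
        unfolding parallelogram_polyhypercubes_def stack_def by blast
    qed
    show "parallelogram_polyhypercubes d k n \<subseteq> ?\<Phi> ` encodings d k n"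
    proof
      fix C assume "C \<in> parallelogram_polyhypercubes d k n"
      then obtain \<beta> \<tau> where C: "C \<in> ?A // translation_rel d"
        and b: "parallelogram_bounds d k \<beta> \<tau>" and mem: "stack d k \<beta> \<tau> \<in> C"
        and n: "\<And>i. i \<in> {1..k} \<Longrightarrow> card (plateau d (int i) (\<beta> i) (\<tau> i)) = n i"
        unfolding parallelogram_polyhypercubes_def polyhypercubes_def stack_def by blast
      obtain W S t where e: "(W, S) \<in> encodings d k n"
        and t: "stack d k \<beta> \<tau> = translate d t (stack d k (bottoms S) (tops W S))"
        using encodings_surj[OF d b n] .
      have "(stack d k (bottoms S) (tops W S), stack d k \<beta> \<tau>) \<in> translation_rel d"
        using stack_polyhypercube[OF d] t by (auto simp: translation_rel_def)
      then have "translation_rel d `` {stack d k (bottoms S) (tops W S)} =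
          translation_rel d `` {stack d k \<beta> \<tau>}"
        by (rule equiv_class_eq[OF equiv])
      \<comment> \<open>\<open>C\<close> is a class containing the given stack, hence it is the
        class of that stack.\<close>
      also have "\<dots> = C"
      proof -
        obtain X where X: "C = translation_rel d `` {X}" using C by (rule quotientE)
        then have "(X, stack d k \<beta> \<tau>) \<in> translation_rel d" using mem by simp
        then show ?thesis unfolding X by (rule equiv_class_eq[OF equiv, symmetric])
      qed
      finally show "C \<in> ?\<Phi> ` encodings d k n" using e by force
    qed
  qed
  then show ?thesis by (simp add: bij_betw_same_card)
qed

section \<open>Comparing the coefficients of the two series\<close>

lemma dirichlet_pow_extensional:
  "f [^]\<^bsub>dirichlet_series k\<^esub> (m::nat) \<in> extensional (dindex k)"
  by (cases m) (simp_all add: nat_pow_def dirichlet_series_def)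

theorem theorem5:
  fixes d k :: nat
  assumes "d \<ge> 4" and "k \<ge> 1"
  shows "P_series d k = V_series k [^]\<^bsub>dirichlet_series k\<^esub> (d - 1)"
\<comment> \<open>Both sides take the default value outside \<open>dindex k\<close>, so it suffices
  to compare coefficients.\<close>
proof (rule extensionalityI)
  show "P_series d k \<in> extensional (dindex k)" by (simp add: P_series_def)
  show "V_series k [^]\<^bsub>dirichlet_series k\<^esub> (d - 1) \<in> extensional (dindex k)"
    by (rule dirichlet_pow_extensional)
  fix n assume n: "n \<in> dindex k"
  \<comment> \<open>The exponent \<open>d - 1\<close> is the number of directions in
    \<open>{2..d}\<close>, which serve as the labels of the factors.\<close>
  have "(V_series k [^]\<^bsub>dirichlet_series k\<^esub> (d - 1)) n =
      (\<Sum>W\<in>factorizations k {2..d} n. \<Prod>r\<in>{2..d}. V_series k (W r))"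
    using dirichlet_pow_coeff[of "{2..d}" n k "V_series k"] n by simp
  also have "\<dots> = (\<Sum>W\<in>factorizations k {2..d} n.
      \<Prod>r\<in>{2..d}. \<Prod>j\<in>{1..<k}. int (min (W r j) (W r (Suc j))))"
    by (intro sum.cong prod.cong refl) (auto simp: V_series_def factorizations_def PiE_iff)
  also have "\<dots> = int (card (encodings d k n))"
    using n by (simp add: card_encodings)
  also have "\<dots> = P_series d k n"
    using assms n by (simp add: P_series_def card_parallelogram_polyhypercubes)
  finally show "P_series d k n = (V_series k [^]\<^bsub>dirichlet_series k\<^esub> (d - 1)) n" by simp
qed

end
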